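(* Consider a port-Hamiltonian descriptor system $(E,J,R,Q,B)$ with $A=(J-R)Q$, $C=B^\top Q$, $(E,A)$ regular, $(E,A,B)$ strongly stabilizable and $(E,A,C)$ strongly detectable, and let $\mathcal P_{\mathrm c},\mathcal P_{\mathrm f}$ be stabilizing solutions of (GC), (GF) such that $I_n+\mathcal P_{\mathrm f}\mathcal P_{\mathrm c}^\top$ is invertible. Let $A_{\mathcal P_{\mathrm c}}=A-BB^\top\mathcal P_{\mathrm c}$ and $\mathcal L=(I_n+\mathcal P_{\mathrm f}\mathcal P_{\mathrm c}^\top)^{-1}\mathcal P_{\mathrm f}$. Then $A_{\mathcal P_{\mathrm c}}\mathcal L^\top+\mathcal LA_{\mathcal P_{\mathrm c}}^\top+BB^\top\preceq0$, $E\mathcal L^\top=\mathcal LE^\top$, $A_{\mathcal P_{\mathrm c}}^\top\mathcal P_{\mathrm c}+\mathcal P_{\mathrm c}^\top A_{\mathcal P_{\mathrm c}}+\begin{bmatrix}-\mathcal P_{\mathrm c}^\top B & C^\top\end{bmatrix}\begin{bmatrix}-\mathcal P_{\mathrm c}^\top B & C^\top\end{bmatrix}^\top=0$, $E^\top\mathcal P_{\mathrm c}=\mathcal P_{\mathrm c}^\top E$.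
   Context: A pH descriptor system: $E,J,R,Q\in\mathbb{R}^{n\times n}$, $B\in\mathbb{R}^{n\times m}$, $E^\top Q=Q^\top E\succeq0$, $J^\top=-J$, $R=R^\top\succeq0$, $A:=(J-R)Q$, $C:=B^\top Q$. Regular pencil: $\det(sE-A)\ne0$ for some $s$; impulse-free: nilpotent part of Weierstraß form vanishes. $(E,A,B)$ strongly stabilizable: $\mathrm{rank}[E\ \ AS\ \ B]=n$ ($\mathrm{im}\,S=\ker E$) and $\mathrm{rank}[\lambda E-A\ \ B]=n$ for $\mathrm{Re}\,\lambda\ge0$; $(E,A,C)$ strongly detectable: $(E^\top,A^\top,C^\top)$ strongly stabilizable. GAREs: (GC) $A^\top\mathcal P_{\mathrm c}+\mathcal P_{\mathrm c}^\top A-\mathcal P_{\mathrm c}^\top BB^\top\mathcal P_{\mathrm c}+C^\top C=0$, $E^\top\mathcal P_{\mathrm c}=\mathcal P_{\mathrm c}^\top E$; (GF) $A\mathcal P_{\mathrm f}^\top+\mathcal P_{\mathrm f}A^\top-\mathcal P_{\mathrm f}C^\top C\mathcal P_{\mathrm f}^\top+BB^\top+2R=0$, $E\mathcal P_{\mathrm f}^\top=\mathcal P_{\mathrm f}E^\top$. Stabilizing: $(E,A-BB^\top\mathcal P_{\mathrm c})$, resp. $(E,A-\mathcal P_{\mathrm f}C^\top C)$, regular, impulse-free with all finite eigenvalues in the open left half-plane. *)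

theory Defs
  imports "HOL-Analysis.Analysis"
begin

section \<open>Matrix helpers\<close>

definition cmat :: "real^'c^'r \<Rightarrow> complex^'c^'r" where
  "cmat M = (\<chi> i j. complex_of_real (M$i$j))"

text \<open>Horizontal block concatenation [X Y].\<close>
definition hcat :: "'a::zero^'c^'r \<Rightarrow> 'a^'d^'r \<Rightarrow> 'a^('c + 'd)^'r" where
  "hcat X Y = (\<chi> i j. case j of Inl k \<Rightarrow> X$i$k | Inr k \<Rightarrow> Y$i$k)"

text \<open>Symmetric positive / negative semidefinite (Loewner order).\<close>
definition psd :: "real^'n^'n \<Rightarrow> bool" where
  "psd M \<longleftrightarrow> transpose M = M \<and> (\<forall>x. 0 \<le> x \<bullet> (M *v x))"

definition nsd :: "real^'n^'n \<Rightarrow> bool" where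
  "nsd M \<longleftrightarrow> transpose M = M \<and> (\<forall>x. x \<bullet> (M *v x) \<le> 0)"

section \<open>Pencils\<close>

definition regular_pencil :: "real^'n^'n \<Rightarrow> real^'n^'n \<Rightarrow> bool" where
  "regular_pencil E A \<longleftrightarrow> (\<exists>s::complex. det ((\<chi> i j. s * cmat E $ i $ j) - cmat A) \<noteq> 0)"

text \<open>Block-diagonal matrix w.r.t. the index partition F / complement of F.\<close>
definition blockdiag :: "'n set \<Rightarrow> real^'n^'n \<Rightarrow> real^'n^'n \<Rightarrow> real^'n^'n" where
  "blockdiag F X Y = (\<chi> i j. if i \<in> F \<and> j \<in> F then X$i$j
                          else if i \<notin> F \<and> j \<notin> F then Y$i$j else 0)"

text \<open>Weierstrass form: W E T = diag(I, N), W A T = diag(J, I), N nilpotent.\<close>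
definition weierstrass_form ::
  "real^'n^'n \<Rightarrow> real^'n^'n \<Rightarrow> real^'n^'n \<Rightarrow> real^'n^'n \<Rightarrow> 'n set
     \<Rightarrow> real^'n^'n \<Rightarrow> real^'n^'n \<Rightarrow> bool" where
  "weierstrass_form E A W T F Jm N \<longleftrightarrow>
     invertible W \<and> invertible T \<and>
     W ** E ** T = blockdiag F (mat 1) N \<and>
     W ** A ** T = blockdiag F Jm (mat 1) \<and>
     (\<exists>k. (((**) (blockdiag F 0 N)) ^^ k) (mat 1) = 0)"

text \<open>Impulse-free: the nilpotent part of the Weierstrass form vanishes.\<close>
definition impulse_free :: "real^'n^'n \<Rightarrow> real^'n^'n \<Rightarrow> bool" where
  "impulse_free E A \<longleftrightarrow>
     (\<exists>W T F Jm N. weierstrass_form E A W T F Jm N \<and> blockdiag F 0 N = 0)"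

text \<open>Finite eigenvalues of the pencil (E,A): roots of det(\<lambda>E - A).\<close>
definition finite_eigenvalues :: "real^'n^'n \<Rightarrow> real^'n^'n \<Rightarrow> complex set" where
  "finite_eigenvalues E A = {z. det ((\<chi> i j. z * cmat E $ i $ j) - cmat A) = 0}"

definition stable_pencil :: "real^'n^'n \<Rightarrow> real^'n^'n \<Rightarrow> bool" where
  "stable_pencil E A \<longleftrightarrow> regular_pencil E A \<and> impulse_free E A \<and>
     (\<forall>z\<in>finite_eigenvalues E A. Re z < 0)"

section \<open>Strong stabilizability / detectability\<close>

definition strongly_stabilizable :: "real^'n^'n \<Rightarrow> real^'n^'n \<Rightarrow> real^'m^'n \<Rightarrow> bool" where
  "strongly_stabilizable E A B \<longleftrightarrow>
     (\<forall>S::real^'n^'n. range (\<lambda>x. S *v x) = {x. E *v x = 0} \<longrightarrow>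
        rank (hcat (hcat E (A ** S)) B) = CARD('n)) \<and>
     (\<forall>z::complex. 0 \<le> Re z \<longrightarrow>
        rank (hcat ((\<chi> i j. z * cmat E $ i $ j) - cmat A) (cmat B)) = CARD('n))"

definition strongly_detectable :: "real^'n^'n \<Rightarrow> real^'n^'n \<Rightarrow> real^'n^'p \<Rightarrow> bool" where
  "strongly_detectable E A C \<longleftrightarrow>
     strongly_stabilizable (transpose E) (transpose A) (transpose C)"

end

theory Submission
  imports Defs
begin

text \<open>
  Expressed through the closed loop APc = A - B B^T Pc and using (GC), the filter equation (GF)
  becomes K APc Pf^T + Pf APc^T K^T + K B B^T K^T = -2R. Congruence with K^-1 turns
  its left-hand side into the Lyapunov expression for L = K^-1 Pf, which is therefore
  negative semidefinite. The remaining identities are (GC) rearranged and the symmetry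
  conditions transported through K.
\<close>

lemma matrix_add_rdistrib: "((A::real^'n^'m) + B) ** (C::real^'p^'n) = A ** C + B ** C"
  by (vector matrix_matrix_mult_def sum.distrib[symmetric] field_simps)

lemma matrix_diff_ldistrib: "(A::real^'n^'m) ** (B - C) = A ** B - A ** (C::real^'p^'n)"
  by (vector matrix_matrix_mult_def sum_subtractf[symmetric] field_simps)

lemma matrix_diff_rdistrib: "((A::real^'n^'m) - B) ** (C::real^'p^'n) = A ** C - B ** C"
  by (vector matrix_matrix_mult_def sum_subtractf[symmetric] field_simps)

lemma matrix_uminus_left: "(- (A::real^'n^'m)) ** (C::real^'p^'n) = - (A ** C)"
  by (vector matrix_matrix_mult_def sum_negf[symmetric])

lemma matrix_uminus_right: "(A::real^'n^'m) ** (- (C::real^'p^'n)) = - (A ** C)"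
  by (vector matrix_matrix_mult_def sum_negf[symmetric])

lemma transpose_add: "transpose ((A::real^'n^'m) + B) = transpose A + transpose B"
  by (vector transpose_def)

lemma transpose_diff: "transpose ((A::real^'n^'m) - B) = transpose A - transpose B"
  by (vector transpose_def)

lemma transpose_uminus: "transpose (- (A::real^'n^'m)) = - transpose A"
  by (vector transpose_def)

lemmas matrix_ring_simps =
  matrix_add_ldistrib matrix_add_rdistrib matrix_diff_ldistrib matrix_diff_rdistrib
  matrix_uminus_left matrix_uminus_right scalar_matrix_assoc[symmetric] matrix_scalar_ac
  transpose_add transpose_diff transpose_uminus transpose_scalar
  matrix_transpose_mul transpose_transpose matrix_mul_assoc

lemma
  assumes "invertible (K::real^'n^'n)"
  shows matrix_inv_right: "K ** matrix_inv K = mat 1"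
    and matrix_inv_left: "matrix_inv K ** K = mat 1"
  using assms unfolding invertible_def matrix_inv_def by (metis (mono_tags, lifting) someI_ex)+

lemma transpose_matrix_inv_cancel_right:
  assumes "invertible (K::real^'n^'n)"
  shows "X ** transpose K ** transpose (matrix_inv K) = (X::real^'n^'m)"
  using matrix_inv_left[OF assms]
  by (metis matrix_transpose_mul matrix_mul_assoc matrix_mul_rid transpose_mat)

lemma hcat_mult_transpose:
  "hcat (X::real^'c^'r) (Y::real^'d^'r) ** transpose (hcat X Y) = X ** transpose X + Y ** transpose Y"
proof -
  have split_sum: "(\<Sum>j\<in>UNIV. f j) = (\<Sum>k\<in>UNIV. f (Inl k)) + (\<Sum>k\<in>UNIV. f (Inr k))"
    for f :: "'c + 'd \<Rightarrow> real"
    using sum.Plus[of UNIV UNIV f] by (simp add: comp_def UNIV_Plus_UNIV)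
  show ?thesis
    unfolding matrix_matrix_mult_def hcat_def transpose_def by (simp add: vec_eq_iff split_sum)
qed

lemma nsd_scaleR_psd:
  assumes "psd R" "c \<le> 0"
  shows "nsd (c *\<^sub>R R)"
proof -
  have "x \<bullet> ((c *\<^sub>R R) *v x) = c * (x \<bullet> (R *v x))" for x
    by (simp flip: scaleR_matrix_vector_assoc)
  then show ?thesis
    using assms unfolding psd_def nsd_def by (simp add: transpose_scalar mult_nonpos_nonneg)
qed

lemma nsd_congruence:
  assumes "nsd M"
  shows "nsd (S ** M ** transpose S)"
proof -
  have "x \<bullet> ((S ** M ** transpose S) *v x) = (transpose S *v x) \<bullet> (M *v (transpose S *v x))" for x
    by (simp add: dot_lmul_matrix flip: matrix_vector_mul_assoc)
  then show ?thesis
    using assms unfolding nsd_def by (simp add: matrix_transpose_mul matrix_mul_assoc)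
qed

lemma filter_riccati_closed_loop:
  fixes A Pc Pf R :: "real^'n^'n" and B :: "real^'m^'n" and C :: "real^'n^'p"
  defines "K \<equiv> mat 1 + Pf ** transpose Pc" and "APc \<equiv> A - B ** transpose B ** Pc"
  assumes GC: "transpose A ** Pc + transpose Pc ** A - transpose Pc ** B ** transpose B ** Pc
                 + transpose C ** C = 0"
    and GF: "A ** transpose Pf + Pf ** transpose A - Pf ** transpose C ** C ** transpose Pf
               + B ** transpose B + 2 *\<^sub>R R = 0"
  shows "K ** APc ** transpose Pf + Pf ** transpose APc ** transpose K
           + K ** (B ** transpose B) ** transpose K = - 2 *\<^sub>R R"
proof -
  have "K ** APc ** transpose Pf + Pf ** transpose APc ** transpose K
          + K ** (B ** transpose B) ** transpose K
      = (A ** transpose Pf + Pf ** transpose A - Pf ** transpose C ** C ** transpose Pf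
           + B ** transpose B + 2 *\<^sub>R R)
        + Pf ** (transpose A ** Pc + transpose Pc ** A - transpose Pc ** B ** transpose B ** Pc
           + transpose C ** C) ** transpose Pf
        - 2 *\<^sub>R R"
    unfolding K_def APc_def by (simp add: matrix_ring_simps algebra_simps)
  then show ?thesis
    using GC GF by simp
qed

lemma lyapunov_congruence_matrix_inv:
  fixes K Pf APc W :: "real^'n^'n"
  assumes "invertible K"
  defines "L \<equiv> matrix_inv K ** Pf"
  shows "APc ** transpose L + L ** transpose APc + W
       = matrix_inv K ** (K ** APc ** transpose Pf + Pf ** transpose APc ** transpose K
                          + K ** W ** transpose K) ** transpose (matrix_inv K)"
  unfolding L_def
  by (simp add: matrix_ring_simps matrix_inv_left[OF assms(1)]
                transpose_matrix_inv_cancel_right[OF assms(1)])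

lemma commute_transpose_matrix_inv:
  fixes E Pc Pf :: "real^'n^'n"
  defines "K \<equiv> mat 1 + Pf ** transpose Pc"
  assumes EPf: "E ** transpose Pf = Pf ** transpose E"
    and EPc: "transpose E ** Pc = transpose Pc ** E"
    and inv: "invertible K"
  shows "E ** transpose (matrix_inv K ** Pf) = (matrix_inv K ** Pf) ** transpose E"
proof -
  have "transpose Pc ** (Pf ** transpose E) = transpose E ** (Pc ** transpose Pf)"
    by (metis EPf EPc matrix_mul_assoc)
  then have "K ** E ** transpose Pf = Pf ** transpose E ** transpose K"
    unfolding K_def by (simp add: matrix_ring_simps EPf flip: matrix_mul_assoc)
  then have "matrix_inv K ** (K ** E ** transpose Pf) ** transpose (matrix_inv K)
           = matrix_inv K ** (Pf ** transpose E ** transpose K) ** transpose (matrix_inv K)"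
    by simp
  then show ?thesis
    by (simp add: matrix_ring_simps matrix_inv_left[OF inv] transpose_matrix_inv_cancel_right[OF inv])
qed

lemma control_riccati_closed_loop:
  fixes A Pc :: "real^'n^'n" and B :: "real^'m^'n" and C :: "real^'n^'p"
  defines "APc \<equiv> A - B ** transpose B ** Pc"
    and "M \<equiv> hcat (- (transpose Pc ** B)) (transpose C)"
  assumes GC: "transpose A ** Pc + transpose Pc ** A - transpose Pc ** B ** transpose B ** Pc
                 + transpose C ** C = 0"
  shows "transpose APc ** Pc + transpose Pc ** APc + M ** transpose M = 0"
  using GC unfolding APc_def M_def hcat_mult_transpose
  by (simp add: matrix_ring_simps algebra_simps)

theorem mainTheorem10:
  fixes E J R Q Pc Pf :: "real^'n^'n" and B :: "real^'m^'n"
  assumes EQ: "transpose E ** Q = transpose Q ** E" "psd (transpose E ** Q)"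
    and skewJ: "transpose J = - J"
    and Rpsd: "psd R"
    and reg: "regular_pencil E ((J - R) ** Q)"
    and stab: "strongly_stabilizable E ((J - R) ** Q) B"
    and det: "strongly_detectable E ((J - R) ** Q) (transpose B ** Q)"
    and GC: "transpose ((J - R) ** Q) ** Pc + transpose Pc ** ((J - R) ** Q)
               - transpose Pc ** B ** transpose B ** Pc
               + transpose (transpose B ** Q) ** (transpose B ** Q) = 0"
    and GC2: "transpose E ** Pc = transpose Pc ** E"
    and GCstab: "stable_pencil E ((J - R) ** Q - B ** transpose B ** Pc)"
    and GF: "((J - R) ** Q) ** transpose Pf + Pf ** transpose ((J - R) ** Q)
               - Pf ** transpose (transpose B ** Q) ** (transpose B ** Q) ** transpose Pf
               + B ** transpose B + 2 *\<^sub>R R = 0"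
    and GF2: "E ** transpose Pf = Pf ** transpose E"
    and GFstab: "stable_pencil E ((J - R) ** Q
                   - Pf ** transpose (transpose B ** Q) ** (transpose B ** Q))"
    and inv: "invertible (mat 1 + Pf ** transpose Pc)"
  shows "let A = (J - R) ** Q; C = transpose B ** Q;
             APc = A - B ** transpose B ** Pc;
             L = matrix_inv (mat 1 + Pf ** transpose Pc) ** Pf;
             M = hcat (- (transpose Pc ** B)) (transpose C)
         in nsd (APc ** transpose L + L ** transpose APc + B ** transpose B)
            \<and> E ** transpose L = L ** transpose E
            \<and> transpose APc ** Pc + transpose Pc ** APc + M ** transpose M = 0
            \<and> transpose E ** Pc = transpose Pc ** E"
proof -
  let ?K = "mat 1 + Pf ** transpose Pc" and ?APc = "(J - R) ** Q - B ** transpose B ** Pc"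
  have "nsd (- 2 *\<^sub>R R)"
    using nsd_scaleR_psd[OF Rpsd, of "- 2"] by simp
  then have "nsd (matrix_inv ?K ** (- 2 *\<^sub>R R) ** transpose (matrix_inv ?K))"
    by (rule nsd_congruence)
  then have "nsd (?APc ** transpose (matrix_inv ?K ** Pf) + (matrix_inv ?K ** Pf) ** transpose ?APc
                  + B ** transpose B)"
    by (simp only: lyapunov_congruence_matrix_inv[OF inv] filter_riccati_closed_loop[OF GC GF])
  then show ?thesis
    using commute_transpose_matrix_inv[OF GF2 GC2 inv] control_riccati_closed_loop[OF GC] GC2
    by (simp add: Let_def)
qed

end
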